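(* For every integer $n \geq 1$, \[\tilde{P}_{n}=-\sum_{j=0}^{n-1} \sum_{k=0}^{\left\lfloor\frac{n-j-1}{2}\right\rfloor} (-1)^{j-k} \binom{j}{k} \sum_{l=0}^{\left\lfloor\frac{n-j-2k-1}{3}\right\rfloor} \frac{2j+2}{n+j-2k-l+1} \binom{n-j-2k-2l-2}{l}\binom{2n-4k-4l-1}{n-j-2k-3l-1}.\]
   Context: Binomial conventions: $\binom{n}{k}=0$ if $k>n\ge 0$, $\binom{n}{-1}=0$ for $n \geq 0$, and a binomial coefficient $\binom{-n}{k}$ with negative upper entry ($n\ge 1$, $k \geq 0$) is taken to be $1$. Set $P_0:=1$ and, for $n\ge 1$, \[P_{n}:=\sum_{k=0}^{\lfloor n/3\rfloor} \frac{1}{n-k+1} \binom{n-2k-1}{k}\binom{2n-4k}{n-3k}.\] Let $P:=\sum_{n\ge 0} P_n X^n \in \mathbb{Z}[[X]]$, and let $P^{-1}=\sum_{n\ge 0}\tilde{P}_n X^n$ be the multiplicative inverse of $P$ in $\mathbb{Z}[[X]]$ (this defines the integers $\tilde{P}_n$). *)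

theory Defs
  imports Complex_Main "HOL-Computational_Algebra.Formal_Power_Series"
begin

text \<open>
  Binomial coefficients with integer entries: zero for a negative lower entry, and one for a
  negative upper entry together with a nonnegative lower entry.  This differs from
  \<^const>\<open>gbinomial\<close>, whose value at \<open>(-1, k)\<close> is \<open>(-1)^k\<close>.
\<close>

definition ibinom :: "int \<Rightarrow> int \<Rightarrow> int" where
  "ibinom n k = (if k < 0 then 0 else if n < 0 then 1 else int (nat n choose nat k))"

definition P_coeff :: "nat \<Rightarrow> rat" where
  "P_coeff n =
    (if n = 0 then 1
     else \<Sum>k = 0..n div 3.
       1 / of_int (int n - int k + 1)
       * of_int (ibinom (int n - 2 * int k - 1) (int k))
       * of_int (ibinom (2 * int n - 4 * int k) (int n - 3 * int k)))"

text \<open>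
  The rational numbers \<open>P_coeff n\<close> are integers, so the floor below changes nothing; see
  \<open>of_int_P_nth\<close>.
\<close>

definition P :: "int fps" where
  "P = Abs_fps (\<lambda>n. \<lfloor>P_coeff n\<rfloor>)"

definition P_inv :: "int fps" where
  "P_inv = (THE Q. P * Q = 1)"

definition P_tilde :: "nat \<Rightarrow> int" where
  "P_tilde n = fps_nth P_inv n"

lemma ibinom_of_nat: "ibinom (int n) (int k) = int (n choose k)"
  by (simp add: ibinom_def)

lemma divide_as_combination:
  fixes b c d f m k N :: rat
  assumes "N \<noteq> 0" and N: "N = m + 2 * k + 1"
    and bf: "(m + k) * b = m * f" and cd: "m * c = N * d"
  shows "b * c / N = b * c + b * d - 2 * (f * d)"
proof -
  define e where "e = b * c / N"
  have e1: "e * N = b * c" using \<open>N \<noteq> 0\<close> by (simp add: e_def)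
  have "(e * m) * N = (b * d) * N" using e1 cd by algebra
  then have e2: "e * m = b * d" using \<open>N \<noteq> 0\<close> by simp
  have "(e * (m + k)) * N = (f * d) * N" using e1 cd bf by algebra
  then have e3: "e * (m + k) = f * d" using \<open>N \<noteq> 0\<close> by simp
  have "e = e * N + e * m - 2 * (e * (m + k))" unfolding N by (simp add: algebra_simps)
  then show ?thesis unfolding e1 e2 e3 by (simp add: e_def)
qed

lemma P_summand_in_Ints:
  fixes n k :: nat
  assumes n: "n \<ge> 1" and k: "k \<le> n div 3"
  shows "(1 / of_int (int n - int k + 1)
       * of_int (ibinom (int n - 2 * int k - 1) (int k))
       * of_int (ibinom (2 * int n - 4 * int k) (int n - 3 * int k)) :: rat) \<in> \<int>"
proof (cases "n = 3 * k")
  case True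
  with n have "k \<ge> 1" by simp
  have eq: "int n - 2 * int k - 1 = int (k - 1)"
    using True \<open>k \<ge> 1\<close> by simp
  have "ibinom (int n - 2 * int k - 1) (int k) = 0"
    unfolding eq ibinom_def using \<open>k \<ge> 1\<close> by (simp add: binomial_eq_0)
  then show ?thesis by simp
next
  case False
  with k have "n > 3 * k" by linarith
  then obtain m where m: "n = Suc m + 3 * k"
    by (metis add.commute add_Suc_right less_imp_Suc_add)
  define B where "B = (m + k) choose k"
  define C where "C = (2 * (Suc m + k)) choose Suc m"
  define D where "D = (2 * (Suc m + k)) choose m"
  define F where "F = (Suc m + k) choose k"
  have b: "ibinom (int n - 2 * int k - 1) (int k) = int B"
  proof -
    have "int n - 2 * int k - 1 = int (m + k)" using m by simp
    then show ?thesis by (simp only: ibinom_of_nat B_def)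
  qed
  have c: "ibinom (2 * int n - 4 * int k) (int n - 3 * int k) = int C"
  proof -
    have "2 * int n - 4 * int k = int (2 * (Suc m + k))"
      and "int n - 3 * int k = int (Suc m)" using m by simp_all
    then show ?thesis by (simp only: ibinom_of_nat C_def)
  qed
  have "Suc m * C = (2 * (Suc m + k) - m) * D"
    unfolding C_def D_def by (simp only: binomial_absorption binomial_absorb_comp)
  moreover have "2 * (Suc m + k) - m = Suc m + 2 * k + 1" by simp
  ultimately have CD: "Suc m * C = (Suc m + 2 * k + 1) * D" by simp
  have BF: "(Suc m + k) * B = Suc m * F"
    using binomial_absorb_comp[of "Suc m + k" k] by (simp add: B_def F_def)
  let ?N = "of_nat (Suc m + 2 * k + 1) :: rat"
  let ?E = "of_nat B * of_nat C / ?N :: rat"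
  have N: "?N \<noteq> 0" by (simp only: of_nat_eq_0_iff)
  have CDr: "of_nat (Suc m) * of_nat C = ?N * (of_nat D :: rat)"
    using CD by (metis of_nat_mult)
  have BFr: "of_nat (Suc m + k) * of_nat B = of_nat (Suc m) * (of_nat F :: rat)"
    using BF by (metis of_nat_mult)
  have "?E = of_nat B * of_nat C + of_nat B * of_nat D - 2 * (of_nat F * of_nat D)"
  proof (rule divide_as_combination[OF N _ _ CDr])
    show "?N = of_nat (Suc m) + 2 * of_nat k + 1" by simp
    show "(of_nat (Suc m) + of_nat k) * of_nat B = of_nat (Suc m) * (of_nat F :: rat)"
      using BFr by (simp only: of_nat_add)
  qed
  also have "\<dots> \<in> \<int>" by simp
  finally have "?E \<in> \<int>" .
  moreover have "int n - int k + 1 = int (Suc m + 2 * k + 1)" using m by simp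
  ultimately show ?thesis unfolding b c by (simp only: of_int_of_nat_eq) simp
qed

lemma P_coeff_in_Ints: "P_coeff n \<in> \<int>"
proof (cases "n = 0")
  case False
  then show ?thesis
    unfolding P_coeff_def if_not_P[OF False]
    by (intro Ints_sum P_summand_in_Ints) auto
qed (simp add: P_coeff_def)

lemma of_int_P_nth: "of_int (fps_nth P n) = P_coeff n"
  using P_coeff_in_Ints[of n] by (simp add: P_def)

lemma ex1_P_inverse: "\<exists>!Q. P * Q = 1"
proof (rule ex_ex1I)
  have "fps_nth P 0 = 1" by (simp add: P_def P_coeff_def)
  then show "\<exists>Q. P * Q = 1"
    using fps_right_inverse[of P 1] by auto
next
  fix Q R assume "P * Q = 1" "P * R = 1"
  then show "Q = R" by (metis mult.assoc mult.commute mult_1)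
qed

lemma P_times_P_inv: "P * P_inv = 1"
  unfolding P_inv_def by (rule theI'[OF ex1_P_inverse])

end

theory Submission
  imports Defs
begin

text \<open>
  Write \<open>N = m + s + 2 * l\<close>. The coefficients of \<open>P\<close>, as well as the inner sums over \<open>l\<close> on the
  right-hand side, are all built from the numbers
  \<open>s / N * binom(m + l - 1, l) * binom(2 * m + 2 * l + s - 1, m)\<close>, with \<open>s = 1\<close> for \<open>P\<close> and
  \<open>s = 2 * j + 2\<close> for the inner sums. This number is \<open>s / N\<close> times the coefficient of
  \<open>x^m z^l\<close> in \<open>(1 - x / (1 - z))^(-N)\<close>, so by Lagrange inversion it is the coefficient of
  \<open>x^m z^l\<close> in the \<open>s\<close>-th power of the solution \<open>p\<close> of \<open>p * (1 - x p / (1 - z p\<^sup>2)) = 1\<close>, that is,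
  of \<open>p = 1 + x p\<^sup>2 + z (p\<^sup>3 - p\<^sup>2)\<close>. Setting \<open>x = X\<close> and \<open>z = X\<^sup>3\<close> gives
  \<open>P = 1 + X P\<^sup>2 + X\<^sup>3 (P\<^sup>3 - P\<^sup>2)\<close> together with the coefficients of all the powers of \<open>P\<close>.

  Lagrange inversion can be replaced by a verification: multiplied by \<open>p^s\<close>, the equation says
  \<open>p^(s+1) = p^s + x p^(s+2) + z (p^(s+3) - p^(s+2))\<close>, and the numbers above satisfy
  this recurrence (\<open>power_coeff_rec\<close>). As every term on the right except the first carries a factor
  \<open>X\<close>, the recurrence determines the whole family of series from its member at \<open>s = 0\<close>
  (\<open>recurrence_zero\<close>), and this forces the family to consist of the powers of its member at
  \<open>s = 1\<close>, which is \<open>P\<close> (\<open>pow_series_eq_power\<close>).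

  The equation for \<open>P\<close> yields \<open>1 - 1 / P = X P\<^sup>2 / (1 - Y)\<close> with \<open>Y = X (X\<^sup>2 - 1) P\<^sup>2\<close>
  (\<open>P_rat_inv_equation\<close>). Expanding \<open>1 / (1 - Y)\<close> as a geometric series produces the sum over \<open>j\<close>,
  expanding \<open>(X\<^sup>2 - 1)^j\<close> by the binomial theorem produces the sum over \<open>k\<close>, and the
  coefficients of \<open>P^(2 * j + 2)\<close> are the inner sums.
\<close>

unbundle fps_syntax

section \<open>The coefficients of the powers of the solution\<close>

text \<open>
  The quotient \<open>s / (m + s + 2 * l)\<close> is \<open>0 / 0\<close> at \<open>s = m = l = 0\<close>, where the coefficient of the
  zeroth power has to be \<open>1\<close>; hence the separate clause. The truncated difference \<open>m + l - 1\<close>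
  is harmless: the binomial coefficient is \<open>1\<close> at \<open>m = l = 0\<close> and \<open>0\<close> at \<open>m = 0 < l\<close>,
  as it should be for the coefficient of \<open>z^l\<close> in \<open>(1 - z)^(-m)\<close>.
\<close>

definition power_coeff :: "nat \<Rightarrow> nat \<Rightarrow> nat \<Rightarrow> rat" where
  "power_coeff s m l =
    (if s = 0 then (if m = 0 \<and> l = 0 then 1 else 0)
     else of_nat s / of_nat (m + s + 2 * l) * of_nat ((m + l - 1) choose l)
          * of_nat ((2 * m + 2 * l + s - 1) choose m))"

lemma power_coeff_eq:
  assumes "m + s + l > 0"
  shows "power_coeff s m l = of_nat s / of_nat (m + s + 2 * l) * of_nat ((m + l - 1) choose l)
          * of_nat ((2 * m + 2 * l + s - 1) choose m)"
  using assms by (auto simp: power_coeff_def)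

lemma power_coeff_0: "power_coeff s 0 l = (if l = 0 then 1 else 0)"
  by (cases l) (auto simp: power_coeff_def)

lemma of_nat_Suc_choose_Suc:
  "of_nat (Suc n choose Suc k) = (of_nat (Suc n) / of_nat (Suc k) * of_nat (n choose k) :: rat)"
  using arg_cong[OF Suc_times_binomial[of k n], of "of_nat :: nat \<Rightarrow> rat"]
  by (simp add: field_simps del: binomial_Suc_Suc)

lemma of_nat_choose_Suc:
  "of_nat (n choose Suc k) = ((of_nat n - of_nat k) / of_nat (Suc k) * of_nat (n choose k) :: rat)"
  using of_nat_Suc_choose_Suc[of n k] by (simp add: field_simps)

text \<open>Multiplication by \<open>x\<close>, respectively \<open>z\<close>, on arrays \<open>f m l\<close> of coefficients of \<open>x^m z^l\<close>.\<close>

definition shift_fst :: "(nat \<Rightarrow> nat \<Rightarrow> rat) \<Rightarrow> nat \<Rightarrow> nat \<Rightarrow> rat" where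
  "shift_fst f m l = (case m of 0 \<Rightarrow> 0 | Suc m' \<Rightarrow> f m' l)"

definition shift_snd :: "(nat \<Rightarrow> nat \<Rightarrow> rat) \<Rightarrow> nat \<Rightarrow> nat \<Rightarrow> rat" where
  "shift_snd f m l = (case l of 0 \<Rightarrow> 0 | Suc l' \<Rightarrow> f m l')"

text \<open>
  The termwise form of \<open>p^(s+1) = p^s + x p^(s+2) + z (p^(s+3) - p^(s+2))\<close>. Away from
  the boundary all binomial coefficients are rational multiples of two of them, here \<open>B\<close> and \<open>E\<close>,
  and the claim becomes a polynomial identity.
\<close>

lemma power_coeff_rec:
  "power_coeff (Suc s) m l = power_coeff s m l + shift_fst (power_coeff (s + 2)) m l
     + (shift_snd (power_coeff (s + 3)) m l - shift_snd (power_coeff (s + 2)) m l)"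
proof (cases m)
  case 0
  then show ?thesis
    by (cases l) (simp_all add: shift_fst_def shift_snd_def power_coeff_0)
next
  case m: (Suc M)
  show ?thesis
  proof (cases l)
    case 0
    define E where "E = (of_nat ((2 * M + s + 1) choose M) :: rat)"
    have 1: "of_nat ((2 * M + s + 2) choose Suc M) = (of_nat (2 * M + s + 2) / of_nat (Suc M) * E :: rat)"
      using of_nat_Suc_choose_Suc[of "2 * M + s + 1" M] by (simp add: E_def)
    have 2: "of_nat ((2 * M + s + 1) choose Suc M) = ((of_nat (2 * M + s + 1) - of_nat M) / of_nat (Suc M) * E :: rat)"
      unfolding E_def by (rule of_nat_choose_Suc)
    have a1: "power_coeff (Suc s) m l = of_nat (s + 1) / of_nat (M + s + 2) * of_nat ((2 * M + s + 2) choose Suc M)"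
      using power_coeff_eq[of m "Suc s" l] by (simp add: m 0)
    have a2: "power_coeff s m l = of_nat s / of_nat (M + s + 1) * of_nat ((2 * M + s + 1) choose Suc M)"
      using power_coeff_eq[of m s l] by (simp add: m 0)
    have a3: "shift_fst (power_coeff (s + 2)) m l = of_nat (s + 2) / of_nat (M + s + 2) * E"
      using power_coeff_eq[of M "s + 2" l] by (simp add: m 0 E_def shift_fst_def)
    define a where "a = (of_nat M + 1 :: rat)"
    define t where "t = (of_nat s :: rat)"
    define c where "c = E / ((a + t + 1) * a)"
    have nz: "a \<noteq> 0" "a + t \<noteq> 0" "a + t + 1 \<noteq> 0"
      using of_nat_neq_0[of M, where ?'a = rat] of_nat_neq_0[of "M + s", where ?'a = rat]
        of_nat_neq_0[of "M + s + 1", where ?'a = rat]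
      by (simp_all add: a_def t_def add_ac)
    have "of_nat (s + 1) / of_nat (M + s + 2) * (of_nat (2 * M + s + 2) / of_nat (Suc M) * E)
        = (t + 1) / (a + t + 1) * ((2 * a + t) / a * E)"
      by (simp add: a_def t_def algebra_simps)
    then have t1: "of_nat (s + 1) / of_nat (M + s + 2) * (of_nat (2 * M + s + 2) / of_nat (Suc M) * E)
        = (t + 1) * (2 * a + t) * c"
      by (simp add: c_def)
    have "of_nat s / of_nat (M + s + 1)
        * ((of_nat (2 * M + s + 1) - of_nat M) / of_nat (Suc M) * E)
        = t / (a + t) * ((a + t) / a * E)"
      by (simp add: a_def t_def algebra_simps)
    then have t2: "of_nat s / of_nat (M + s + 1)
        * ((of_nat (2 * M + s + 1) - of_nat M) / of_nat (Suc M) * E)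
        = t * (a + t + 1) * c"
      using nz by (simp add: c_def)
    have "of_nat (s + 2) / of_nat (M + s + 2) * E = (t + 2) / (a + t + 1) * E"
      by (simp add: a_def t_def algebra_simps)
    then have t3: "of_nat (s + 2) / of_nat (M + s + 2) * E = (t + 2) * a * c"
      using nz by (simp add: c_def)
    have "power_coeff (Suc s) m l = power_coeff s m l + shift_fst (power_coeff (s + 2)) m l"
      unfolding a1 a2 a3 1 2 t1 t2 t3 by (simp add: algebra_simps)
    then show ?thesis by (simp add: shift_snd_def 0)
  next
    case l: (Suc L)
    define T where "T = 2 * M + 2 * L + s + 3"
    define B where "B = (of_nat ((M + L) choose L) :: rat)"
    define E where "E = (of_nat (T choose M) :: rat)"
    define D where "D = (of_nat (M + 2 * L + s + 3) :: rat)"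
    define u where "u = (of_nat M + 1 :: rat)"
    define v where "v = (of_nat L + 1 :: rat)"
    define t where "t = (of_nat s :: rat)"
    have b1: "of_nat (Suc (M + L) choose Suc L) = (u + v - 1) / v * B"
      using of_nat_Suc_choose_Suc[of "M + L" L] by (simp add: B_def u_def v_def add_ac del: binomial_Suc_Suc)
    have b2: "of_nat ((M + L) choose Suc L) = (u - 1) / v * B"
      using of_nat_choose_Suc[of "M + L" L] by (simp add: B_def u_def v_def add_ac del: binomial_Suc_Suc)
    have e1: "of_nat (Suc T choose Suc M) = (D + u) / u * E"
      using of_nat_Suc_choose_Suc[of T M]
      by (simp add: E_def T_def u_def D_def algebra_simps del: binomial_Suc_Suc)
    have e2: "of_nat (T choose Suc M) = D / u * E"
      using of_nat_choose_Suc[of T M]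
      by (simp add: E_def T_def u_def D_def algebra_simps del: binomial_Suc_Suc)
    have nz: "D \<noteq> 0" "D + 1 \<noteq> 0" "u \<noteq> 0" "v \<noteq> 0"
      using of_nat_neq_0[of "M + 2 * L + s + 2", where ?'a = rat]
        of_nat_neq_0[of "M + 2 * L + s + 3", where ?'a = rat]
        of_nat_neq_0[of M, where ?'a = rat] of_nat_neq_0[of L, where ?'a = rat]
      by (simp_all add: D_def u_def v_def add_ac)
    have a1: "power_coeff (Suc s) m l = (t + 1) / (D + 1) * of_nat (Suc (M + L) choose Suc L) * of_nat (Suc T choose Suc M)"
      by (subst power_coeff_eq) (simp_all add: m l D_def T_def t_def add_ac numeral_eq_Suc del: binomial_Suc_Suc)
    have a2: "power_coeff s m l = t / D * of_nat (Suc (M + L) choose Suc L) * of_nat (T choose Suc M)"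
      by (subst power_coeff_eq) (simp_all add: m l D_def T_def t_def add_ac numeral_eq_Suc del: binomial_Suc_Suc)
    have a3: "shift_fst (power_coeff (s + 2)) m l = (t + 2) / (D + 1) * of_nat ((M + L) choose Suc L) * E"
      by (simp add: shift_fst_def m del: binomial_Suc_Suc, subst power_coeff_eq)
        (simp_all add: l D_def T_def t_def E_def add_ac numeral_eq_Suc del: binomial_Suc_Suc)
    have a4: "shift_snd (power_coeff (s + 3)) m l = (t + 3) / (D + 1) * B * of_nat (Suc T choose Suc M)"
      by (simp add: shift_snd_def l del: binomial_Suc_Suc, subst power_coeff_eq)
        (simp_all add: m D_def T_def t_def B_def add_ac numeral_eq_Suc del: binomial_Suc_Suc)
    have a5: "shift_snd (power_coeff (s + 2)) m l = (t + 2) / D * B * of_nat (T choose Suc M)"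
      by (simp add: shift_snd_def l del: binomial_Suc_Suc, subst power_coeff_eq)
        (simp_all add: m D_def T_def t_def B_def add_ac numeral_eq_Suc del: binomial_Suc_Suc)
    have D: "D = u + 2 * v + t"
      by (simp add: D_def u_def v_def t_def)
    define W where "W = D + 1"
    define c where "c = B * E / (W * u * v)"
    have "W \<noteq> 0" using nz by (simp add: W_def)
    have t1: "(t + 1) / W * ((u + v - 1) / v * B) * ((D + u) / u * E) = (t + 1) * (u + v - 1) * (D + u) * c"
      by (simp add: c_def mult_ac)
    have t2: "t / D * ((u + v - 1) / v * B) * (D / u * E) = t * (u + v - 1) * W * c"
      using nz \<open>W \<noteq> 0\<close> by (simp add: c_def mult_ac)
    have t3: "(t + 2) / W * ((u - 1) / v * B) * E = (t + 2) * (u - 1) * u * c"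
      using nz by (simp add: c_def mult_ac)
    have t4: "(t + 3) / W * B * ((D + u) / u * E) = (t + 3) * v * (D + u) * c"
      using nz by (simp add: c_def mult_ac)
    have t5: "(t + 2) / D * B * (D / u * E) = (t + 2) * v * W * c"
      using nz \<open>W \<noteq> 0\<close> by (simp add: c_def mult_ac)
    \<comment> \<open>The recurrence divided by the common factor \<open>c\<close> of its five terms.\<close>
    have poly: "(t + 1) * (u + v - 1) * (D + u) = t * (u + v - 1) * W + (t + 2) * (u - 1) * u
        + ((t + 3) * v * (D + u) - (t + 2) * v * W)"
      unfolding W_def D by (simp add: algebra_simps)
    have "(t + 1) / (D + 1) * ((u + v - 1) / v * B) * ((D + u) / u * E) =
       t / D * ((u + v - 1) / v * B) * (D / u * E) + (t + 2) / (D + 1) * ((u - 1) / v * B) * E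
       + ((t + 3) / (D + 1) * B * ((D + u) / u * E) - (t + 2) / D * B * (D / u * E))"
      unfolding W_def[symmetric] t1 t2 t3 t4 t5 poly
      by (simp only: distrib_right left_diff_distrib)
    then show ?thesis
      unfolding a1 a2 a3 a4 a5 b1 b2 e1 e2 .
  qed
qed

section \<open>Specialization to one variable\<close>

text \<open>The substitution \<open>x = X\<close>, \<open>z = X\<^sup>3\<close> in the bivariate series with coefficients \<open>f\<close>.\<close>

definition collapse :: "(nat \<Rightarrow> nat \<Rightarrow> rat) \<Rightarrow> rat fps" where
  "collapse f = Abs_fps (\<lambda>n. \<Sum>l = 0..n div 3. f (n - 3 * l) l)"

lemma collapse_shift_fst: "collapse (shift_fst f) = fps_X * collapse f"
proof (rule fps_ext)
  fix n
  show "collapse (shift_fst f) $ n = (fps_X * collapse f) $ n"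
  proof (cases n)
    case 0
    then show ?thesis by (simp add: collapse_def shift_fst_def)
  next
    case (Suc N)
    have "(\<Sum>l = 0..Suc N div 3. shift_fst f (Suc N - 3 * l) l) = (\<Sum>l = 0..N div 3. f (N - 3 * l) l)"
    proof (rule sum.mono_neutral_cong_right)
      show "\<forall>l\<in>{0..Suc N div 3} - {0..N div 3}. shift_fst f (Suc N - 3 * l) l = 0"
      proof
        fix l assume "l \<in> {0..Suc N div 3} - {0..N div 3}"
        then have "Suc N - 3 * l = 0" by auto
        then show "shift_fst f (Suc N - 3 * l) l = 0" by (simp add: shift_fst_def)
      qed
      fix l assume "l \<in> {0..N div 3}"
      then have "Suc N - 3 * l = Suc (N - 3 * l)" by auto
      then show "shift_fst f (Suc N - 3 * l) l = f (N - 3 * l) l" by (simp add: shift_fst_def)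
    qed (auto simp: div_le_mono)
    then show ?thesis by (simp add: Suc collapse_def)
  qed
qed

lemma collapse_shift_snd: "collapse (shift_snd f) = fps_X ^ 3 * collapse f"
proof (rule fps_ext)
  fix n
  show "collapse (shift_snd f) $ n = (fps_X ^ 3 * collapse f) $ n"
  proof (cases "n < 3")
    case True
    then show ?thesis by (simp add: collapse_def shift_snd_def fps_X_power_mult_nth)
  next
    case False
    then obtain N where n: "n = N + 3" by (metis add.commute le_Suc_ex not_less)
    have "(\<Sum>l = 0..n div 3. shift_snd f (n - 3 * l) l)
        = (\<Sum>l = 0..Suc (N div 3). shift_snd f (n - 3 * l) l)"
      by (simp add: n)
    also have "\<dots> = (\<Sum>l = 0..N div 3. f (N - 3 * l) l)"
      by (subst sum.atLeast0_atMost_Suc_shift) (simp add: shift_snd_def n)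
    finally show ?thesis
      using False by (simp add: collapse_def fps_X_power_mult_nth n)
  qed
qed

lemma collapse_add: "collapse (\<lambda>m l. f m l + g m l) = collapse f + collapse g"
  by (rule fps_ext) (simp add: collapse_def sum.distrib)

lemma collapse_diff: "collapse (\<lambda>m l. f m l - g m l) = collapse f - collapse g"
  by (rule fps_ext) (simp add: collapse_def sum_subtractf)

definition pow_series :: "nat \<Rightarrow> rat fps" where
  "pow_series s = collapse (power_coeff s)"

lemma pow_series_0: "pow_series 0 = 1"
proof (rule fps_ext)
  fix n
  show "pow_series 0 $ n = (1 :: rat fps) $ n"
    by (cases "n = 0") (auto simp: pow_series_def collapse_def power_coeff_def intro!: sum.neutral)
qed

lemma pow_series_rec:
  "pow_series (Suc s) = pow_series s + fps_X * pow_series (s + 2)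
     + fps_X ^ 3 * (pow_series (s + 3) - pow_series (s + 2))"
proof -
  have "pow_series (Suc s) = collapse (\<lambda>m l. power_coeff s m l + shift_fst (power_coeff (s + 2)) m l
     + (shift_snd (power_coeff (s + 3)) m l - shift_snd (power_coeff (s + 2)) m l))"
    unfolding pow_series_def power_coeff_rec[symmetric] ..
  also have "\<dots> = pow_series s + fps_X * pow_series (s + 2)
      + (fps_X ^ 3 * pow_series (s + 3) - fps_X ^ 3 * pow_series (s + 2))"
    by (simp only: collapse_add collapse_diff collapse_shift_fst collapse_shift_snd pow_series_def)
  finally show ?thesis by (simp add: algebra_simps)
qed

text \<open>
  Modulo \<open>X^(n+1)\<close>, and once all coefficients below \<open>n\<close> are known to vanish, the recurrence
  reads \<open>D (Suc s) = D s\<close>; so the vanishing at \<open>n\<close> propagates from \<open>D 0\<close>.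
\<close>

lemma recurrence_zero:
  fixes D :: "nat \<Rightarrow> rat fps"
  assumes D0: "D 0 = 0"
    and rec: "\<And>s. D (Suc s) = D s + fps_X * D (s + 2) + fps_X ^ 3 * (D (s + 3) - D (s + 2))"
  shows "D s = 0"
proof (rule fps_ext)
  fix n
  have "D s $ n = 0" for s
  proof (induction n arbitrary: s rule: less_induct)
    case (less n)
    have *: "D (Suc s) $ n = D s $ n" for s
      by (subst rec) (simp add: fps_X_power_mult_nth less.IH del: add_2_eq_Suc')
    show ?case
      by (induction s) (simp_all add: * D0)
  qed
  then show "D s $ n = 0 $ n" by simp
qed

text \<open>
  The recurrence is linear, so multiplying a solution by a fixed series gives a solution. The shifted
  family \<open>pow_series (Suc s)\<close> and the family \<open>pow_series s * pow_series 1\<close> are therefore both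
  solutions, and they agree at \<open>s = 0\<close>.
\<close>

lemma pow_series_eq_power: "pow_series s = pow_series 1 ^ s"
proof (induction s)
  case (Suc s)
  define D where "D s = pow_series (Suc s) - pow_series s * pow_series 1" for s
  have rec: "D (Suc s) = D s + fps_X * D (s + 2) + fps_X ^ 3 * (D (s + 3) - D (s + 2))" for s
  proof -
    have "D (Suc s) = pow_series (Suc s) + fps_X * pow_series (Suc s + 2)
       + fps_X ^ 3 * (pow_series (Suc s + 3) - pow_series (Suc s + 2))
       - (pow_series s + fps_X * pow_series (s + 2) +
          fps_X ^ 3 * (pow_series (s + 3) - pow_series (s + 2))) * pow_series 1"
      unfolding D_def pow_series_rec[of s, symmetric] pow_series_rec[of "Suc s", symmetric] ..
    then show ?thesis unfolding D_def by (simp add: algebra_simps)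
  qed
  have "D 0 = 0" by (simp add: D_def pow_series_0)
  then have "D s = 0" using rec by (rule recurrence_zero)
  then have "pow_series (Suc s) = pow_series s * pow_series 1"
    unfolding D_def by (simp only: right_minus_eq)
  then show ?case by (simp only: Suc.IH power_Suc2)
qed (simp add: pow_series_0)

lemma pow_series_1_equation:
  "pow_series 1 = 1 + fps_X * pow_series 1 ^ 2 + fps_X ^ 3 * (pow_series 1 ^ 3 - pow_series 1 ^ 2)"
  using pow_series_rec[of 0] pow_series_eq_power[of 2] pow_series_eq_power[of 3]
  by (simp only: pow_series_0 add_0 One_nat_def)

section \<open>Identification with \<open>P\<close>\<close>

text \<open>
  The two conventions for an upper entry \<open>-1\<close> agree: \<open>ibinom (-1) 0\<close> and \<open>0 choose 0\<close> are both \<open>1\<close>,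
  and this is the only negative upper entry that occurs.
\<close>

lemma ibinom_pred_add:
  assumes "(a::int) = int m + int l - 1" "b = int l"
  shows "ibinom a b = int ((m + l - 1) choose l)"
  using assms unfolding ibinom_def
  by (cases "m + l = 0") (auto simp: nat_diff_distrib nat_add_distrib)

lemma pow_series_nth:
  assumes "s > 0"
  shows "pow_series s $ n = (\<Sum>l = 0..n div 3. of_nat s / of_int (int n + int s - int l)
     * of_int (ibinom (int n - 2 * int l - 1) (int l))
     * of_int (ibinom (2 * int n - 4 * int l + int s - 1) (int n - 3 * int l)))"
  unfolding pow_series_def collapse_def fps_nth_Abs_fps
proof (rule sum.cong[OF refl])
  fix l assume "l \<in> {0..n div 3}"
  then obtain m where n: "n = m + 3 * l"
    by (metis add.commute atLeastAtMost_iff le_Suc_ex less_eq_div_iff_mult_less_eq mult.commute zero_less_numeral)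
  have 1: "int n + int s - int l = int (m + s + 2 * l)" by (simp add: n)
  have 2: "ibinom (int n - 2 * int l - 1) (int l) = int ((m + l - 1) choose l)"
    by (rule ibinom_pred_add) (simp_all add: n)
  have 3: "2 * int n - 4 * int l + int s - 1 = int (2 * m + 2 * l + s - 1)"
    using assms by (simp add: n of_nat_diff)
  have 4: "int n - 3 * int l = int m" by (simp add: n)
  show "power_coeff s (n - 3 * l) l = of_nat s / of_int (int n + int s - int l)
     * of_int (ibinom (int n - 2 * int l - 1) (int l))
     * of_int (ibinom (2 * int n - 4 * int l + int s - 1) (int n - 3 * int l))"
    unfolding 1 2 3 4 ibinom_of_nat using assms by (simp add: n power_coeff_def)
qed

lemma pow_series_1_nth: "pow_series 1 $ n = of_int (P $ n)"
proof (cases "n = 0")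
  case True
  then show ?thesis
    by (simp add: of_int_P_nth P_coeff_def pow_series_def collapse_def power_coeff_def)
next
  case False
  then show ?thesis
    unfolding of_int_P_nth P_coeff_def by (simp add: pow_series_nth algebra_simps)
qed

definition P_rat :: "rat fps" where "P_rat = Abs_fps (\<lambda>n. of_int (P $ n))"

lemma P_rat_eq: "P_rat = pow_series 1"
  by (rule fps_ext) (simp only: pow_series_1_nth P_rat_def fps_nth_Abs_fps)

definition P_rat_inv :: "rat fps" where "P_rat_inv = Abs_fps (\<lambda>n. of_int (P_tilde n))"

lemma P_rat_times_inv: "P_rat * P_rat_inv = 1"
proof (rule fps_ext)
  fix n
  have "(P_rat * P_rat_inv) $ n = of_int ((P * P_inv) $ n)"
    by (simp add: fps_mult_nth P_rat_def P_rat_inv_def P_tilde_def)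
  also have "\<dots> = 1 $ n" by (simp add: P_times_P_inv)
  finally show "(P_rat * P_rat_inv) $ n = 1 $ n" .
qed

section \<open>The inverse of \<open>P\<close>\<close>

text \<open>
  The equation for \<open>r\<close> can be regrouped as \<open>1 - x (x\<^sup>2 - 1) r\<^sup>2 = r (1 - x\<^sup>3 r\<^sup>2)\<close>, and the factor
  \<open>r\<close> turns \<open>1 - q\<close> into \<open>r - 1\<close>.
\<close>

lemma inverse_equation:
  fixes r q x :: "'a :: comm_ring_1"
  assumes rq: "r * q = 1" and r: "r = 1 + x * r ^ 2 + x ^ 3 * (r ^ 3 - r ^ 2)"
  shows "(1 - x * (x ^ 2 - 1) * r ^ 2) * (1 - q) = x * r ^ 2"
proof -
  have "1 - x * (x ^ 2 - 1) * r ^ 2 = (1 + x * r ^ 2 + x ^ 3 * (r ^ 3 - r ^ 2)) - x ^ 3 * r ^ 3"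
    by (simp add: algebra_simps power2_eq_square power3_eq_cube)
  also have "\<dots> = r * (1 - x ^ 3 * r ^ 2)"
    unfolding r[symmetric] by (simp add: algebra_simps power2_eq_square power3_eq_cube)
  finally have *: "1 - x * (x ^ 2 - 1) * r ^ 2 = r * (1 - x ^ 3 * r ^ 2)" .
  have "(1 - x * (x ^ 2 - 1) * r ^ 2) * (1 - q) = (r - r * q) * (1 - x ^ 3 * r ^ 2)"
    unfolding * by (simp add: algebra_simps)
  also have "\<dots> = r - 1 - x ^ 3 * (r ^ 3 - r ^ 2)"
    unfolding rq by (simp add: algebra_simps power2_eq_square power3_eq_cube)
  also have "\<dots> = x * r ^ 2"
    by (subst (1) r) simp
  finally show ?thesis .
qed

lemma P_rat_inv_equation:
  "(1 - fps_X * (fps_X ^ 2 - 1) * P_rat ^ 2) * (1 - P_rat_inv) = fps_X * P_rat ^ 2"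
  by (rule inverse_equation[OF P_rat_times_inv pow_series_1_equation[folded P_rat_eq]])

text \<open>
  A geometric sum with \<open>n\<close> terms is enough: the remainder after them is divisible by
  \<open>X^(n+1)\<close>, because \<open>Y\<close> is divisible by \<open>X\<close> and there is a further factor \<open>X\<close> in front.
\<close>

lemma nth_inv_geometric:
  assumes "n \<ge> 1"
  shows "P_rat_inv $ n = - ((\<Sum>j<n. fps_X ^ (j + 1) * ((fps_X ^ 2 - 1) ^ j * P_rat ^ (2 * j + 2))) $ n)"
proof -
  define Y where "Y = (fps_X * (fps_X ^ 2 - 1) * P_rat ^ 2 :: rat fps)"
  define S where "S = (\<Sum>j<n. Y ^ j) * (fps_X * P_rat ^ 2)"
  have S: "S = (\<Sum>j<n. fps_X ^ (j + 1) * ((fps_X ^ 2 - 1) ^ j * P_rat ^ (2 * j + 2)))"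
    unfolding S_def sum_distrib_right
  proof (rule sum.cong[OF refl])
    fix j
    have "P_rat ^ (2 * j + 2) = (P_rat ^ 2) ^ j * P_rat ^ 2" by (simp only: power_add power_mult)
    then show "Y ^ j * (fps_X * P_rat ^ 2) = fps_X ^ (j + 1) * ((fps_X ^ 2 - 1) ^ j * P_rat ^ (2 * j + 2))"
      by (simp only: Y_def power_mult_distrib) (simp add: mult_ac)
  qed
  have Y0: "(1 - Y) $ 0 \<noteq> 0" by (simp add: Y_def mult.assoc)
  have "(1 - Y) * (1 - P_rat_inv) = fps_X * P_rat ^ 2"
    unfolding Y_def by (rule P_rat_inv_equation)
  moreover have "(1 - Y) * S = (1 - Y ^ n) * (fps_X * P_rat ^ 2)"
    by (simp add: S_def one_diff_power_eq mult.assoc)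
  ultimately have "(1 - Y) * (1 - P_rat_inv - S) = Y ^ n * (fps_X * P_rat ^ 2)"
    by (simp only: right_diff_distrib[of "1 - Y" "1 - P_rat_inv" S]) (simp add: algebra_simps)
  then have "inverse (1 - Y) * (1 - Y) * (1 - P_rat_inv - S) = inverse (1 - Y) * (Y ^ n * (fps_X * P_rat ^ 2))"
    by (simp add: mult.assoc)
  then have "1 - P_rat_inv - S = inverse (1 - Y) * (Y ^ n * (fps_X * P_rat ^ 2))"
    using inverse_mult_eq_1[OF Y0] by simp
  also have "\<dots> = fps_X ^ (n + 1) * (inverse (1 - Y) * ((fps_X ^ 2 - 1) * P_rat ^ 2) ^ n * P_rat ^ 2)"
    by (simp add: Y_def power_mult_distrib mult_ac)
  finally have "(1 - P_rat_inv - S) $ n = 0"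
    by (simp only: fps_X_power_mult_nth) simp
  then show ?thesis
    using assms unfolding S[symmetric] by simp
qed

lemma nth_X2_minus_1_power_mult:
  fixes F :: "rat fps"
  shows "((fps_X ^ 2 - 1) ^ j * F) $ N
    = (\<Sum>k = 0..N div 2. (-1) powi (int j - int k) * of_nat (j choose k) * F $ (N - 2 * k))"
proof -
  let ?t = "\<lambda>k. (-1) powi (int j - int k) * of_nat (j choose k)
     * (if N < 2 * k then 0 else F $ (N - 2 * k)) :: rat"
  have "(fps_X ^ 2 - 1 :: rat fps) ^ j = (\<Sum>k\<le>j. of_nat (j choose k) * (fps_X ^ 2) ^ k * (-1) ^ (j - k))"
    using binomial_ring[of "fps_X ^ 2 :: rat fps" "-1" j] by simp
  also have "\<dots> = (\<Sum>k\<le>j. fps_X ^ (2 * k) * fps_const ((-1) powi (int j - int k) * of_nat (j choose k)))"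
  proof (rule sum.cong[OF refl])
    fix k assume "k \<in> {..j}"
    then have "(-1) powi (int j - int k) = ((-1) ^ (j - k) :: rat)"
      by (simp flip: of_nat_diff)
    moreover have "(-1 :: rat fps) ^ (j - k) = fps_const ((-1) ^ (j - k))"
      by (metis fps_const_1_eq_1 fps_const_neg fps_const_power)
    ultimately show "of_nat (j choose k) * (fps_X ^ 2) ^ k * (-1) ^ (j - k)
        = fps_X ^ (2 * k) * fps_const ((-1) powi (int j - int k) * of_nat (j choose k) :: rat)"
      by (simp add: fps_of_nat[symmetric] mult_ac flip: power_mult)
  qed
  finally have "((fps_X ^ 2 - 1) ^ j * F) $ N = (\<Sum>k\<le>j. ?t k)"
    by (simp add: sum_distrib_right fps_sum_nth mult.assoc fps_X_power_mult_nth
        fps_mult_left_const_nth cong: if_cong)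
      (auto intro!: sum.cong)
  \<comment> \<open>The terms with \<open>k > j\<close> vanish by the binomial coefficient, those with \<open>2 * k > N\<close> by degree.\<close>
  also have "\<dots> = (\<Sum>k\<in>{..j} \<union> {0..N div 2}. ?t k)"
    by (rule sum.mono_neutral_left) (auto simp: binomial_eq_0)
  also have "\<dots> = (\<Sum>k = 0..N div 2. ?t k)"
    by (rule sum.mono_neutral_right) auto
  also have "\<dots> = (\<Sum>k = 0..N div 2. (-1) powi (int j - int k) * of_nat (j choose k) * F $ (N - 2 * k))"
    by (rule sum.cong) auto
  finally show ?thesis .
qed

theorem mainTheorem1:
  fixes n :: nat
  assumes "n \<ge> 1"
  shows "(of_int (P_tilde n) :: rat) =
    - (\<Sum>j = 0..n - 1. \<Sum>k = 0..(n - j - 1) div 2.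
        (-1) powi (int j - int k) * of_nat (j choose k)
        * (\<Sum>l = 0..(n - j - 2 * k - 1) div 3.
            of_nat (2 * j + 2) / of_int (int n + int j - 2 * int k - int l + 1)
            * of_int (ibinom (int n - int j - 2 * int k - 2 * int l - 2) (int l))
            * of_int (ibinom (2 * int n - 4 * int k - 4 * int l - 1)
                             (int n - int j - 2 * int k - 3 * int l - 1))))"
proof -
  have inner: "(\<Sum>l = 0..(n - j - 2 * k - 1) div 3.
            of_nat (2 * j + 2) / of_int (int n + int j - 2 * int k - int l + 1)
            * of_int (ibinom (int n - int j - 2 * int k - 2 * int l - 2) (int l))
            * of_int (ibinom (2 * int n - 4 * int k - 4 * int l - 1)
                             (int n - int j - 2 * int k - 3 * int l - 1)))
      = P_rat ^ (2 * j + 2) $ (n - j - 1 - 2 * k)"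
    if jk: "j < n" "k \<le> (n - j - 1) div 2" for j k
  proof -
    have N: "int (n - j - 2 * k - 1) = int n - int j - 2 * int k - 1"
      using jk by linarith
    have "P_rat ^ (2 * j + 2) $ (n - j - 1 - 2 * k) = pow_series (2 * j + 2) $ (n - j - 2 * k - 1)"
      using pow_series_eq_power[of "2 * j + 2"] by (simp add: P_rat_eq diff_right_commute)
    also have "\<dots> = (\<Sum>l = 0..(n - j - 2 * k - 1) div 3.
            of_nat (2 * j + 2) / of_int (int n + int j - 2 * int k - int l + 1)
            * of_int (ibinom (int n - int j - 2 * int k - 2 * int l - 2) (int l))
            * of_int (ibinom (2 * int n - 4 * int k - 4 * int l - 1)
                             (int n - int j - 2 * int k - 3 * int l - 1)))"
      by (subst pow_series_nth, simp, unfold N) (simp add: algebra_simps)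
    finally show ?thesis ..
  qed
  have "of_int (P_tilde n) = P_rat_inv $ n" by (simp add: P_rat_inv_def)
  also have "\<dots> = - (\<Sum>j = 0..n - 1. (fps_X ^ (j + 1) * ((fps_X ^ 2 - 1) ^ j * P_rat ^ (2 * j + 2))) $ n)"
  proof -
    have "{..<n} = {0..n - 1}" using assms by auto
    then show ?thesis unfolding nth_inv_geometric[OF assms] fps_sum_nth by (simp only:)
  qed
  also have "\<dots> = - (\<Sum>j = 0..n - 1. \<Sum>k = 0..(n - j - 1) div 2.
        (-1) powi (int j - int k) * of_nat (j choose k) * P_rat ^ (2 * j + 2) $ (n - j - 1 - 2 * k))"
  proof (rule arg_cong[where f = uminus], rule sum.cong[OF refl])
    fix j assume "j \<in> {0..n - 1}"
    then have "\<not> n < j + 1" using assms by auto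
    then show "(fps_X ^ (j + 1) * ((fps_X ^ 2 - 1) ^ j * P_rat ^ (2 * j + 2))) $ n =
       (\<Sum>k = 0..(n - j - 1) div 2.
        (-1) powi (int j - int k) * of_nat (j choose k) * P_rat ^ (2 * j + 2) $ (n - j - 1 - 2 * k))"
      by (simp only: fps_X_power_mult_nth nth_X2_minus_1_power_mult if_False diff_diff_left)
  qed
  also have "\<dots> = - (\<Sum>j = 0..n - 1. \<Sum>k = 0..(n - j - 1) div 2.
        (-1) powi (int j - int k) * of_nat (j choose k)
        * (\<Sum>l = 0..(n - j - 2 * k - 1) div 3.
            of_nat (2 * j + 2) / of_int (int n + int j - 2 * int k - int l + 1)
            * of_int (ibinom (int n - int j - 2 * int k - 2 * int l - 2) (int l))
            * of_int (ibinom (2 * int n - 4 * int k - 4 * int l - 1)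
                             (int n - int j - 2 * int k - 3 * int l - 1))))"
    using assms by (intro arg_cong[where f = uminus] sum.cong refl) (subst inner, auto)
  finally show ?thesis .
qed

end
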